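(* For every finite simple graph $G$, $\left| b_g(G) - \widehat{b_g}(G) \right| \le 1$.
   Context: All graphs are finite, simple and undirected. The brushing game on a graph $G$ is played by two players, Max and Min. Initially all vertices are dirty and no vertex contains any brushes. The players alternate turns. On each turn, the player whose turn it is adds one brush to any dirty vertex. After this, if some dirty vertex $v$ has at least as many brushes as it has dirty neighbors, then $v$ fires: one brush is added to each dirty neighbor of $v$, and $v$ itself is marked clean. Vertices continue to fire, sequentially (in an arbitrary order; the order does not affect the outcome), until no more vertices may fire, at which point the turn ends. If at this point all vertices of $G$ are clean, the game ends. The length of the game is the number of brushes placed by the players (the number of turns). Min aims to minimize it, Max aims to maximize it. When both players play optimally, the length of the game is denoted $b_g(G)$ (the game brush number) if Min takes the first turn, and $\widehat{b_g}(G)$ if Max takes the first turn. *)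

theory Defs
  imports "Graph_Theory.Pair_Digraph"
begin

text \<open>
  Finite simple undirected graphs are represented by the locale \<^locale>\<open>pair_graph\<close>
  (finite, loop-free, symmetric).

  A position of the brushing game is a partial function \<open>s\<close>: its domain is the set of dirty
  vertices, and \<open>s v = Some k\<close> says that the dirty vertex \<open>v\<close> holds \<open>k\<close> brushes.  The brushes
  lying on clean vertices have no influence on the game and are not recorded; without them the
  outcome of a turn is literally independent of the firing order.
\<close>

type_synonym 'a position = "'a \<Rightarrow> nat option"

definition initial_position :: "'a pair_pre_digraph \<Rightarrow> 'a position" where
  "initial_position G = (\<lambda>v. if v \<in> pverts G then Some 0 else None)"

definition dirty_nbrs :: "'a pair_pre_digraph \<Rightarrow> 'a position \<Rightarrow> 'a \<Rightarrow> 'a set" where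
  "dirty_nbrs G s v = {w \<in> dom s. v \<rightarrow>\<^bsub>G\<^esub> w}"

definition can_fire :: "'a pair_pre_digraph \<Rightarrow> 'a position \<Rightarrow> 'a \<Rightarrow> bool" where
  "can_fire G s v \<longleftrightarrow> (\<exists>k. s v = Some k \<and> card (dirty_nbrs G s v) \<le> k)"

definition fire :: "'a pair_pre_digraph \<Rightarrow> 'a \<Rightarrow> 'a position \<Rightarrow> 'a position" where
  "fire G v s =
     (\<lambda>w. if w = v then None else if w \<in> dirty_nbrs G s v then map_option Suc (s w) else s w)"

definition fires_to :: "'a pair_pre_digraph \<Rightarrow> 'a position \<Rightarrow> 'a position \<Rightarrow> bool" where
  "fires_to G s s' \<longleftrightarrow> (\<exists>v. can_fire G s v \<and> s' = fire G v s)"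

definition stable :: "'a pair_pre_digraph \<Rightarrow> 'a position \<Rightarrow> bool" where
  "stable G s \<longleftrightarrow> (\<forall>v. \<not> can_fire G s v)"

definition stabilize :: "'a pair_pre_digraph \<Rightarrow> 'a position \<Rightarrow> 'a position" where
  "stabilize G s = (THE s'. (fires_to G)\<^sup>*\<^sup>* s s' \<and> stable G s')"

definition add_brush :: "'a \<Rightarrow> 'a position \<Rightarrow> 'a position" where
  "add_brush v s = s(v := map_option Suc (s v))"

definition turn :: "'a pair_pre_digraph \<Rightarrow> 'a \<Rightarrow> 'a position \<Rightarrow> 'a position" where
  "turn G v s = stabilize G (add_brush v s)"

lemma fire_apply:
  "fire G v s w =
     (if w = v then None else if w \<in> dirty_nbrs G s v then map_option Suc (s w) else s w)"
  by (simp add: fire_def)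

lemma dom_fire: "dom (fire G v s) = dom s - {v}"
  by (auto simp: fire_def dom_def split: if_splits)

lemma dom_add_brush [simp]: "dom (add_brush v s) = dom s"
  by (auto simp: add_brush_def dom_def)

lemma dirty_nbrs_fire: "dirty_nbrs G (fire G u s) v = dirty_nbrs G s v - {u}"
  by (auto simp: dirty_nbrs_def dom_fire)

lemma can_fire_in_dom: "can_fire G s v \<Longrightarrow> v \<in> dom s"
  by (auto simp: can_fire_def)

lemma finite_dirty_nbrs: "finite (dom s) \<Longrightarrow> finite (dirty_nbrs G s v)"
  by (auto simp: dirty_nbrs_def intro: finite_subset[of _ "dom s"])

lemma can_fire_fire:
  assumes "finite (dom s)" "can_fire G s v" "v \<noteq> u"
  shows "can_fire G (fire G u s) v"
proof -
  obtain k where k: "s v = Some k" "card (dirty_nbrs G s v) \<le> k"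
    using assms(2) by (auto simp: can_fire_def)
  have "card (dirty_nbrs G s v - {u}) \<le> card (dirty_nbrs G s v)"
    by (intro card_mono finite_dirty_nbrs assms) auto
  then show ?thesis
    using k assms(3) by (auto simp: can_fire_def dirty_nbrs_fire fire_apply)
qed

lemma fire_commute: "u \<noteq> v \<Longrightarrow> fire G u (fire G v s) = fire G v (fire G u s)"
  by (rule ext) (auto simp: fire_apply dirty_nbrs_fire)

lemma stabilize_exists:
  assumes "finite (dom s)"
  shows "\<exists>s'. (fires_to G)\<^sup>*\<^sup>* s s' \<and> stable G s'"
  using assms
proof (induction "card (dom s)" arbitrary: s rule: less_induct)
  case less
  show ?case
  proof (cases "stable G s")
    case True
    then show ?thesis by blast
  next
    case False
    then obtain v where v: "can_fire G s v" by (auto simp: stable_def)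
    have "card (dom (fire G v s)) < card (dom s)"
      unfolding dom_fire using less.prems can_fire_in_dom[OF v] by (rule card_Diff1_less)
    moreover have "finite (dom (fire G v s))"
      using less.prems by (simp add: dom_fire)
    ultimately obtain s' where "(fires_to G)\<^sup>*\<^sup>* (fire G v s) s'" "stable G s'"
      using less.hyps by blast
    moreover have "fires_to G s (fire G v s)" using v by (auto simp: fires_to_def)
    ultimately show ?thesis by (meson converse_rtranclp_into_rtranclp)
  qed
qed

text \<open>The firing order does not affect the outcome.\<close>

lemma stabilize_unique:
  assumes "finite (dom s)"
    and "(fires_to G)\<^sup>*\<^sup>* s s1" "stable G s1"
    and "(fires_to G)\<^sup>*\<^sup>* s s2" "stable G s2"
  shows "s1 = s2"
  using assms
proof (induction "card (dom s)" arbitrary: s s1 s2 rule: less_induct)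
  case less
  note fin = \<open>finite (dom s)\<close>
  show ?case
  proof (cases "stable G s")
    case True
    then have "\<not> fires_to G s t" for t by (auto simp: stable_def fires_to_def)
    then show ?thesis
      using less.prems by (metis converse_rtranclpE)
  next
    case False
    then have "s \<noteq> s1" "s \<noteq> s2" using less.prems by auto
    then obtain u v where
      u: "can_fire G s u" "(fires_to G)\<^sup>*\<^sup>* (fire G u s) s1" and
      v: "can_fire G s v" "(fires_to G)\<^sup>*\<^sup>* (fire G v s) s2"
      using less.prems by (metis converse_rtranclpE fires_to_def)
    have smaller: "card (dom (fire G w s)) < card (dom s)" "finite (dom (fire G w s))"
      if "can_fire G s w" for w
      using card_Diff1_less[OF fin can_fire_in_dom[OF that]] fin by (simp_all add: dom_fire)
    show ?thesis
    proof (cases "u = v")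
      case True
      then show ?thesis
        using less.hyps[OF smaller[OF u(1)]] less.prems u v by blast
    next
      case False
      let ?t = "fire G v (fire G u s)"
      have t: "fires_to G (fire G u s) ?t" "fires_to G (fire G v s) ?t"
        using can_fire_fire[OF fin u(1)] can_fire_fire[OF fin v(1)] False
          fire_commute[OF False]
        unfolding fires_to_def by metis+
      have "finite (dom ?t)" using fin by (simp add: dom_fire)
      then obtain s' where s': "(fires_to G)\<^sup>*\<^sup>* ?t s'" "stable G s'"
        using stabilize_exists by blast
      have "s1 = s'"
        using less.hyps[OF smaller[OF u(1)] u(2) less.prems(3)] t(1) s'
        by (meson converse_rtranclp_into_rtranclp)
      moreover have "s2 = s'"
        using less.hyps[OF smaller[OF v(1)] v(2) less.prems(5)] t(2) s'
        by (meson converse_rtranclp_into_rtranclp)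
      ultimately show ?thesis by simp
    qed
  qed
qed

lemma stabilize:
  assumes "finite (dom s)"
  shows "(fires_to G)\<^sup>*\<^sup>* s (stabilize G s)" "stable G (stabilize G s)"
proof -
  have "\<exists>!s'. (fires_to G)\<^sup>*\<^sup>* s s' \<and> stable G s'"
    using stabilize_exists[OF assms] stabilize_unique[OF assms] by blast
  from theI'[OF this, folded stabilize_def]
  show "(fires_to G)\<^sup>*\<^sup>* s (stabilize G s)" "stable G (stabilize G s)" by simp_all
qed

lemma fires_to_dom: "fires_to G s t \<Longrightarrow> dom t \<subset> dom s"
  using can_fire_in_dom unfolding fires_to_def by (metis dom_fire Diff_subset Diff_iff insertI1 psubsetI)

lemma fires_to_rtranclp_dom: "(fires_to G)\<^sup>*\<^sup>* s t \<Longrightarrow> t = s \<or> dom t \<subset> dom s"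
  by (induction rule: rtranclp_induct) (use fires_to_dom in \<open>blast+\<close>)

lemma turn_cases:
  assumes "finite (dom s)"
  shows "stable G (add_brush v s) \<and> turn G v s = add_brush v s \<or> dom (turn G v s) \<subset> dom s"
  using stabilize[of "add_brush v s" G] fires_to_rtranclp_dom[of G "add_brush v s" "turn G v s"]
    assms by (auto simp: turn_def)

definition missing_brushes :: "'a position \<Rightarrow> nat" where
  "missing_brushes s = (\<Sum>v\<in>dom s. card (dom s) - the (s v))"

lemma turn_decreases:
  assumes fin: "finite (dom s)" and v: "v \<in> dom s"
  shows "card (dom (turn G v s)) < card (dom s) \<or>
    card (dom (turn G v s)) = card (dom s) \<and> missing_brushes (turn G v s) < missing_brushes s"
  using turn_cases[OF fin, of G v]
proof
  assume "dom (turn G v s) \<subset> dom s"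
  then show ?thesis using psubset_card_mono[OF fin] by blast
next
  assume st: "stable G (add_brush v s) \<and> turn G v s = add_brush v s"
  obtain k where k: "s v = Some k" using v by auto
  have "\<not> card (dirty_nbrs G (add_brush v s) v) \<le> Suc k"
    using st k by (auto simp: stable_def can_fire_def add_brush_def)
  moreover have "card (dirty_nbrs G (add_brush v s) v) \<le> card (dom s)"
    by (intro card_mono fin) (use dom_add_brush[of v s] in \<open>auto simp only: dirty_nbrs_def\<close>)
  ultimately have "Suc k < card (dom s)" by linarith
  then have "missing_brushes (add_brush v s) < missing_brushes s"
    unfolding missing_brushes_def dom_add_brush
    using k v by (intro sum_strict_mono_ex1 fin) (auto simp: add_brush_def intro!: bexI[of _ v])
  then show ?thesis using st by simp
qed

text \<open>
  The number of brushes still to be placed from position \<open>s\<close> under optimal play, when Min,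
  respectively Max, is to move.  The finiteness test only serves to make the recursion total.
\<close>

function min_to_move :: "'a pair_pre_digraph \<Rightarrow> 'a position \<Rightarrow> nat"
  and max_to_move :: "'a pair_pre_digraph \<Rightarrow> 'a position \<Rightarrow> nat" where
  "min_to_move G s =
     (if finite (dom s) \<and> dom s \<noteq> {} then 1 + (MIN v\<in>dom s. max_to_move G (turn G v s)) else 0)"
| "max_to_move G s =
     (if finite (dom s) \<and> dom s \<noteq> {} then 1 + (MAX v\<in>dom s. min_to_move G (turn G v s)) else 0)"
  by pat_completeness auto

termination
  by (relation "inv_image (less_than <*lex*> less_than)
        (\<lambda>x. let s = (case x of Inl p \<Rightarrow> snd p | Inr p \<Rightarrow> snd p) in (card (dom s), missing_brushes s))")
     (auto simp: Let_def dest: turn_decreases)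

declare min_to_move.simps [simp del] max_to_move.simps [simp del]

text \<open>\<open>b\<^sub>g\<close> is the length of the game when Min takes the first turn, \<open>b\<^sub>g_hat\<close> when Max does.\<close>

definition game_brush_number :: "'a pair_pre_digraph \<Rightarrow> nat"  (\<open>b\<^sub>g\<close>) where
  "b\<^sub>g G = min_to_move G (initial_position G)"

definition game_brush_number_hat :: "'a pair_pre_digraph \<Rightarrow> nat"  (\<open>b\<^sub>g'_hat\<close>) where
  "b\<^sub>g_hat G = max_to_move G (initial_position G)"

end

theory Submission
  imports Defs
begin

text \<open>
  The proof rests on a continuation principle: a position that is further along never needs
  more brushes, whoever is to move. "Further along" is the relation \<open>advanced\<close> below. Facing
  the advanced position \<open>t\<close>, Min imagines that the game is played from the earlier position \<open>s\<close>,
  copies the moves of Max into it and answers with an optimal move there. Max can only move at vertices dirty in \<open>t\<close>, and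
  these are dirty in \<open>s\<close> as well. If the imagined optimal reply of Min is a vertex that is already
  clean in \<open>t\<close>, then \<open>t\<close> has absorbed that brush and Min may place a brush anywhere. The real
  game stays advanced over the imagined one (\<open>advanced_turn\<close>, \<open>advanced_turn_clean\<close>), so it
  does not end later; this is \<open>continuation_principle\<close>.

  Every turn advances the position. Hence a move \<open>v\<close> leads to a position \<open>turn G v s\<close> from which
  the player who moves next needs at most as many brushes as that same player would need when
  moving first from \<open>s\<close>. Taking \<open>v\<close> to be an optimal move of Max shows that the length with Max
  first exceeds the length with Min first by at most one; taking \<open>v\<close> to be any move of Min shows
  the converse bound.
\<close>

section \<open>Advanced positions\<close>

text \<open>
  Vertices may be fired here even when they lack the brushes to do so. Dropping this condition
  makes the steps commute freely, so that no brushes have to be counted when an advanced position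
  is compared with the original one after both have changed.
\<close>

inductive advanced :: "'a pair_pre_digraph \<Rightarrow> 'a position \<Rightarrow> 'a position \<Rightarrow> bool"
  for G s where
  refl: "advanced G s s"
| add_brush: "advanced G s t \<Longrightarrow> advanced G s (add_brush v t)"
| fire: "advanced G s t \<Longrightarrow> v \<in> dom t \<Longrightarrow> advanced G s (fire G v t)"

lemma advanced_trans:
  assumes "advanced G s t" "advanced G t r"
  shows "advanced G s r"
  using assms(2,1) by (induction) (auto intro: advanced.intros)

lemma advanced_dom: "advanced G s t \<Longrightarrow> dom t \<subseteq> dom s"
  by (induction rule: advanced.induct) (auto simp only: dom_add_brush dom_fire)

lemma advanced_fires_to: "(fires_to G)\<^sup>*\<^sup>* s t \<Longrightarrow> advanced G s t"
  by (induction rule: rtranclp_induct)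
     (auto simp: fires_to_def intro: advanced.intros dest: can_fire_in_dom)

lemma add_brush_commute: "add_brush u (add_brush v s) = add_brush v (add_brush u s)"
  by (auto simp: add_brush_def)

lemma dirty_nbrs_add_brush [simp]: "dirty_nbrs G (add_brush v s) u = dirty_nbrs G s u"
  by (simp only: dirty_nbrs_def dom_add_brush)

lemma add_brush_fire: "add_brush v (fire G u s) = fire G u (add_brush v s)"
  by (rule ext) (auto simp: fire_apply add_brush_def dirty_nbrs_def)

lemma add_brush_clean: "v \<notin> dom s \<Longrightarrow> add_brush v s = s"
  by (auto simp: add_brush_def domIff)

lemma advanced_add_brush_both:
  "advanced G s t \<Longrightarrow> advanced G (add_brush v s) (add_brush v t)"
proof (induction rule: advanced.induct)
  case (add_brush t u)
  then show ?case
    by (subst add_brush_commute) (rule advanced.add_brush)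
next
  case (fire t u)
  then have "u \<in> dom (add_brush v t)" by (simp only: dom_add_brush)
  with fire.IH show ?case
    unfolding add_brush_fire by (rule advanced.fire)
qed (rule advanced.refl)

text \<open>
  If \<open>u\<close> is clean in \<open>t\<close>, then one of the steps from \<open>s\<close> to \<open>t\<close> fired it, and firing \<open>u\<close>
  first merely brings this step forward.
\<close>

lemma advanced_fire_both:
  "advanced G s t \<Longrightarrow> u \<in> dom s \<Longrightarrow>
    advanced G (fire G u s) (if u \<in> dom t then fire G u t else t)"
proof (induction rule: advanced.induct)
  case refl
  then show ?case by (auto intro: advanced.refl)
next
  case (add_brush t v)
  from advanced.add_brush[OF add_brush.IH[OF add_brush.prems], of v]
  show ?case
    by (cases "u \<in> dom t") (simp_all only: add_brush_fire dom_add_brush if_True if_False)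
next
  case (fire t v)
  show ?case
  proof (cases "u = v")
    case True
    then show ?thesis using fire by (simp add: dom_fire)
  next
    case False
    let ?t' = "if u \<in> dom t then fire G u t else t"
    have "v \<in> dom ?t'" using False fire.hyps by (simp add: dom_fire)
    with fire.IH[OF fire.prems] have "advanced G (fire G u s) (fire G v ?t')"
      by (rule advanced.fire)
    then show ?thesis
      using False by (cases "u \<in> dom t") (simp_all add: dom_fire fire_commute)
  qed
qed

lemma can_fire_add_brush: "can_fire G s u \<Longrightarrow> can_fire G (add_brush v s) u"
  unfolding can_fire_def dirty_nbrs_add_brush by (auto simp: add_brush_def intro: le_SucI)

lemma advanced_can_fire:
  assumes "advanced G s t" "finite (dom s)" "can_fire G s u" "u \<in> dom t"
  shows "can_fire G t u"
  using assms
proof (induction rule: advanced.induct)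
  case (add_brush t v)
  then have "can_fire G t u" by (simp only: dom_add_brush)
  then show ?case by (rule can_fire_add_brush)
next
  case (fire t v)
  then have "u \<noteq> v" "can_fire G t u" by (auto simp only: dom_fire)
  moreover have "finite (dom t)"
    using advanced_dom[OF fire.hyps(1)] fire.prems(1) by (rule finite_subset)
  ultimately show ?case by (intro can_fire_fire)
qed

section \<open>Turns and advanced positions\<close>

text \<open>
  A vertex that can fire in \<open>s\<close> must be clean in \<open>t\<close>, for it could fire in \<open>t\<close> as well if it were
  dirty there. So the stable position \<open>t\<close> already contains all that follows from \<open>s\<close>.
\<close>

lemma advanced_stable:
  assumes "(fires_to G)\<^sup>*\<^sup>* s s'" "advanced G s t" "finite (dom s)" "stable G t"
  shows "advanced G s' t"
  using assms
proof (induction rule: converse_rtranclp_induct)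
  case (step s r)
  then obtain u where u: "can_fire G s u" "r = fire G u s" by (auto simp: fires_to_def)
  have "u \<notin> dom t"
    using advanced_can_fire step.prems u(1) by (metis stable_def)
  then have "advanced G r t"
    using advanced_fire_both[OF step.prems(1) can_fire_in_dom[OF u(1)]] u(2) by simp
  then show ?case using step u(2) by (simp add: dom_fire)
qed

lemma advanced_stabilize:
  assumes "finite (dom s)"
  shows "advanced G s (stabilize G s)"
  using stabilize(1)[OF assms] by (rule advanced_fires_to)

lemma advanced_stabilize_both:
  assumes "advanced G s t" "finite (dom s)"
  shows "advanced G (stabilize G s) (stabilize G t)"
proof -
  have fin: "finite (dom t)"
    using advanced_dom[OF assms(1)] assms(2) by (rule finite_subset)
  show ?thesis
    using stabilize(1)[OF assms(2)] advanced_trans[OF assms(1) advanced_stabilize[OF fin]]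
      assms(2) stabilize(2)[OF fin]
    by (rule advanced_stable)
qed

lemma advanced_turn_self:
  assumes "finite (dom s)"
  shows "advanced G s (turn G v s)"
proof -
  have "advanced G s (add_brush v s)" by (intro advanced.intros)
  moreover have "finite (dom (add_brush v s))" by (simp only: dom_add_brush assms)
  ultimately show ?thesis
    unfolding turn_def by (blast intro: advanced_trans advanced_stabilize)
qed

lemma advanced_turn:
  assumes "advanced G s t" "finite (dom s)"
  shows "advanced G (turn G v s) (turn G v t)"
  unfolding turn_def
  by (rule advanced_stabilize_both[OF advanced_add_brush_both[OF assms(1)]])
     (simp only: dom_add_brush assms)

text \<open>
  The brush placed on \<open>v\<close> is lost on \<open>t\<close>, so \<open>t\<close> is advanced over \<open>s\<close> even after the move at \<open>v\<close>;
  any brush added to \<open>t\<close> only increases the lead.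
\<close>

lemma advanced_turn_clean:
  assumes "advanced G s t" "finite (dom s)" "v \<notin> dom t"
  shows "advanced G (turn G v s) (turn G w t)"
proof -
  have "advanced G (add_brush v s) t"
    using advanced_add_brush_both[OF assms(1), of v] add_brush_clean[OF assms(3)] by simp
  then show ?thesis
    unfolding turn_def
    by (intro advanced_stabilize_both advanced.add_brush) (simp_all only: dom_add_brush assms)
qed

lemma finite_dom_turn: "finite (dom s) \<Longrightarrow> finite (dom (turn G v s))"
  using advanced_dom[OF advanced_turn_self] by (rule finite_subset)

section \<open>The continuation principle\<close>

lemma min_to_move_le:
  assumes "finite (dom s)" "v \<in> dom s"
  shows "min_to_move G s \<le> 1 + max_to_move G (turn G v s)"
  using assms by (subst min_to_move.simps) (auto intro!: Min_le)

lemma min_to_move_attained: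
  assumes "finite (dom s)" "dom s \<noteq> {}"
  obtains v where "v \<in> dom s" "min_to_move G s = 1 + max_to_move G (turn G v s)"
proof -
  have "(MIN v\<in>dom s. max_to_move G (turn G v s)) \<in> (\<lambda>v. max_to_move G (turn G v s)) ` dom s"
    using assms by (intro Min_in) auto
  then obtain v where v: "v \<in> dom s" "(MIN v\<in>dom s. max_to_move G (turn G v s)) = max_to_move G (turn G v s)"
    by blast
  have "min_to_move G s = 1 + (MIN v\<in>dom s. max_to_move G (turn G v s))"
    using assms by (subst min_to_move.simps) simp
  then show thesis using that v by simp
qed

lemma max_to_move_ge:
  assumes "finite (dom s)" "v \<in> dom s"
  shows "1 + min_to_move G (turn G v s) \<le> max_to_move G s"
  using assms by (subst max_to_move.simps) (auto intro!: Max_ge)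

lemma max_to_move_attained:
  assumes "finite (dom s)" "dom s \<noteq> {}"
  obtains v where "v \<in> dom s" "max_to_move G s = 1 + min_to_move G (turn G v s)"
proof -
  have "(MAX v\<in>dom s. min_to_move G (turn G v s)) \<in> (\<lambda>v. min_to_move G (turn G v s)) ` dom s"
    using assms by (intro Max_in) auto
  then obtain v where v: "v \<in> dom s" "(MAX v\<in>dom s. min_to_move G (turn G v s)) = min_to_move G (turn G v s)"
    by blast
  have "max_to_move G s = 1 + (MAX v\<in>dom s. min_to_move G (turn G v s))"
    using assms by (subst max_to_move.simps) simp
  then show thesis using that v by simp
qed

lemma to_move_clean:
  assumes "dom s = {}"
  shows "min_to_move G s = 0" "max_to_move G s = 0"
  using assms by (simp_all add: min_to_move.simps max_to_move.simps)

lemma continuation_principle: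
  shows "advanced G s t \<Longrightarrow> finite (dom s) \<Longrightarrow> min_to_move G t \<le> min_to_move G s"
    and "advanced G s t \<Longrightarrow> finite (dom s) \<Longrightarrow> max_to_move G t \<le> max_to_move G s"
proof (induction G s and G s arbitrary: t and t rule: min_to_move_max_to_move.induct)
  case (1 G s)
  note adv = 1(2) and fin = 1(3)
  have sub: "dom t \<subseteq> dom s" using adv by (rule advanced_dom)
  have fint: "finite (dom t)" using sub fin by (rule finite_subset)
  show ?case
  proof (cases "dom t = {}")
    case True
    then show ?thesis by (simp add: to_move_clean)
  next
    case False
    then have ne: "dom s \<noteq> {}" using sub by auto
    obtain v where v: "v \<in> dom s" "min_to_move G s = 1 + max_to_move G (turn G v s)"
      using min_to_move_attained[OF fin ne] .
    obtain w where w: "w \<in> dom t" "advanced G (turn G v s) (turn G w t)"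
      using False advanced_turn[OF adv fin] advanced_turn_clean[OF adv fin] by blast
    have "max_to_move G (turn G w t) \<le> max_to_move G (turn G v s)"
      using 1(1) fin ne v(1) w(2) finite_dom_turn[OF fin] by blast
    then show ?thesis using min_to_move_le[OF fint w(1), of G] v(2) by linarith
  qed
next
  case (2 G s)
  note adv = 2(2) and fin = 2(3)
  have sub: "dom t \<subseteq> dom s" using adv by (rule advanced_dom)
  have fint: "finite (dom t)" using sub fin by (rule finite_subset)
  show ?case
  proof (cases "dom t = {}")
    case True
    then show ?thesis by (simp add: to_move_clean)
  next
    case False
    then have ne: "dom s \<noteq> {}" using sub by auto
    obtain w where w: "w \<in> dom t" "max_to_move G t = 1 + min_to_move G (turn G w t)"
      using max_to_move_attained[OF fint False] .
    have ws: "w \<in> dom s" using w(1) sub by blast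
    have "min_to_move G (turn G w t) \<le> min_to_move G (turn G w s)"
      using 2(1) fin ne ws advanced_turn[OF adv fin] finite_dom_turn[OF fin] by blast
    then show ?thesis using max_to_move_ge[OF fin ws, of G] w(2) by linarith
  qed
qed

section \<open>The value of the first turn\<close>

lemma to_move_diff_le_1:
  assumes fin: "finite (dom s)"
  shows "\<bar>int (min_to_move G s) - int (max_to_move G s)\<bar> \<le> 1"
proof (cases "dom s = {}")
  case True
  then show ?thesis by (simp add: to_move_clean)
next
  case False
  then obtain v where v: "v \<in> dom s" by blast
  have "max_to_move G (turn G v s) \<le> max_to_move G s"
    using continuation_principle(2)[OF advanced_turn_self[OF fin] fin] .
  then have "min_to_move G s \<le> 1 + max_to_move G s"
    using min_to_move_le[OF fin v, of G] by linarith
  moreover obtain w where "max_to_move G s = 1 + min_to_move G (turn G w s)"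
    using max_to_move_attained[OF fin False] .
  then have "max_to_move G s \<le> 1 + min_to_move G s"
    using continuation_principle(1)[OF advanced_turn_self[OF fin] fin] by simp
  ultimately show ?thesis by linarith
qed

theorem theorem1:
  fixes G :: "'a pair_pre_digraph"
  assumes "pair_graph G"
  shows "\<bar>int (b\<^sub>g G) - int (b\<^sub>g_hat G)\<bar> \<le> 1"
proof -
  interpret pair_graph G by (rule assms)
  have "dom (initial_position G) = pverts G"
    by (auto simp: initial_position_def dom_def)
  then have "finite (dom (initial_position G))" by simp
  then show ?thesis
    unfolding game_brush_number_def game_brush_number_hat_def by (rule to_move_diff_le_1)
qed

end
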